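(* (i) The matricial symbol function of the kagome framework $\mathcal{G}_{kag}$ determined by the six-edge motif is $$\Phi_{kag}(z,w)=\frac14\begin{bmatrix}-2&0&2&0&0&0\\ 0&0&1&-\sqrt3&-1&\sqrt3\\ -1&-\sqrt3&0&0&1&\sqrt3\\ 2&0&-2z&0&0&0\\ 0&0&-1&\sqrt3&\bar z w&-\sqrt3\,\bar z w\\ \bar w&\sqrt3\,\bar w&0&0&-1&-\sqrt3\end{bmatrix}.$$ (ii) The determinant of $\Phi_{kag}(z,w)$ is a constant multiple of $$zw(\bar z-1)(\bar w-1)(\bar z-\bar w).$$ (iii) The kagome framework is square-summably isostatic.
   Context: The kagome framework: with $a_1=(1,0)$, $a_2=(1/2,\sqrt3/2)$, the framework points in $\mathbb{R}^2$ are the translates by $ia_1+ja_2$, $(i,j)\in\mathbb{Z}^2$, of $p_1=(0,0)$, $p_2=(1/2,0)$, $p_3=(1/4,\sqrt3/4)$, and the edges are the translates of the six motif edges, in order: $[p_1,p_2]$, $[p_2,p_3]$, $[p_1,p_3]$, $[p_1,p_2-a_1]$, $[p_2,p_3+a_1-a_2]$, $[p_3,p_1+a_2]$. The motif vertices are $p_1,p_2,p_3$. The rigidity matrix $R$ acts by $(Ru)_e=(p_v-p_w)\cdot(u_v-u_w)$ for an edge $e=vw$. The matricial symbol function $\Phi(z,w)$ on $\mathbb{T}^2$ of a motif has rows indexed by the motif edges and columns by $x,y$ coordinates of motif vertices in order ($p_1^x,p_1^y,p_2^x,\dots$): for a motif edge $e$ joining the translate of $p_s$ by index $(i,j)$ and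 the translate of $p_t$ by index $(k,l)$, with $v_e$ the first position minus the second, row $e$ has entries $\bar z^i\bar w^jv_e$ in the columns of $p_s$, $-\bar z^k\bar w^lv_e$ in the columns of $p_t$, and zero elsewhere. Square-summably isostatic: there is no nonzero square-summable $u=(u_v)_v$ with $Ru=0$ and no nonzero square-summable $s=(s_e)_e$ with $R^ts=0$, where $R^t$ is the transpose. *)

theory Defs
  imports
    "HOL-Analysis.Infinite_Sum"
    "HOL-Analysis.Euclidean_Space"
    "Jordan_Normal_Form.Determinant"
begin

unbundle inner_syntax
no_notation scalar_prod (infix "\<bullet>" 70)

section \<open>Bar-joint frameworks in the plane\<close>

text \<open>The plane is \<open>real \<times> real\<close>. An edge carries an ordered pair of endpoints, but nothing below
  depends on the order.\<close>

record ('v, 'e) framework =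
  joints :: "'v set"
  bars :: "'e set"
  ends :: "'e \<Rightarrow> 'v \<times> 'v"
  place :: "'v \<Rightarrow> real \<times> real"

definition rigidity_map ::
  "('v, 'e) framework \<Rightarrow> ('v \<Rightarrow> real \<times> real) \<Rightarrow> 'e \<Rightarrow> real" where
  "rigidity_map F u e = (case ends F e of (v, w) \<Rightarrow> (place F v - place F w) \<bullet> (u v - u w))"

text \<open>The matrix entries of the rigidity map in row \<open>e\<close> and the two columns of \<open>v\<close>, as a vector.\<close>

definition rigidity_entries :: "('v, 'e) framework \<Rightarrow> 'e \<Rightarrow> 'v \<Rightarrow> real \<times> real" where
  "rigidity_entries F e x = (case ends F e of (v, w) \<Rightarrow>
     (if x = v then place F v - place F w else 0) + (if x = w then place F w - place F v else 0))"

definition incident_bars :: "('v, 'e) framework \<Rightarrow> 'v \<Rightarrow> 'e set" where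
  "incident_bars F v = {e \<in> bars F. v = fst (ends F e) \<or> v = snd (ends F e)}"

text \<open>The entries at the two rows of \<open>v\<close> of the transposed matrix applied to \<open>s\<close>. The sum ranges over
  all rows with a possibly nonzero entry; it is meaningful only if finitely many bars
  meet at \<open>v\<close>, see \<open>finite_incident_bars\<close> below.\<close>

definition rigidity_transpose ::
  "('v, 'e) framework \<Rightarrow> ('e \<Rightarrow> real) \<Rightarrow> 'v \<Rightarrow> real \<times> real" where
  "rigidity_transpose F s v = (\<Sum>e\<in>incident_bars F v. s e *\<^sub>R rigidity_entries F e v)"

lemma rigidity_map_eq_entries:
  "rigidity_map F u e
     = (\<Sum>v\<in>{fst (ends F e), snd (ends F e)}. rigidity_entries F e v \<bullet> u v)"
  by (cases "fst (ends F e) = snd (ends F e)")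
     (auto simp: rigidity_map_def rigidity_entries_def split_beta inner_diff_left inner_diff_right)

text \<open>Only the values of \<open>u\<close> on joints and of \<open>s\<close> on bars are relevant.\<close>

definition square_summably_isostatic :: "('v, 'e) framework \<Rightarrow> bool" where
  "square_summably_isostatic F \<longleftrightarrow>
     (\<nexists>u :: 'v \<Rightarrow> real \<times> real.
        (\<lambda>v. (norm (u v))\<^sup>2) summable_on joints F \<and> (\<exists>v\<in>joints F. u v \<noteq> 0) \<and>
        (\<forall>e\<in>bars F. rigidity_map F u e = 0)) \<and>
     (\<nexists>s :: 'e \<Rightarrow> real.
        (\<lambda>e. (s e)\<^sup>2) summable_on bars F \<and> (\<exists>e\<in>bars F. s e \<noteq> 0) \<and>
        (\<forall>v\<in>joints F. rigidity_transpose F s v = 0))"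


section \<open>Crystal frameworks and the symbol function of a motif\<close>

text \<open>A label \<open>(s, i, j)\<close> stands for the translate, by \<open>i\<close> times the first plus \<open>j\<close> times the second
  period vector, of the motif vertex (or of the motif edge) in position \<open>s\<close>, counted from 0.\<close>

type_synonym label = "nat \<times> int \<times> int"

record motif =
  period1 :: "real \<times> real"
  period2 :: "real \<times> real"
  motif_verts :: "(real \<times> real) list"
  motif_edges :: "(label \<times> label) list"

definition point :: "motif \<Rightarrow> label \<Rightarrow> real \<times> real" where
  "point M = (\<lambda>(s, i, j). motif_verts M ! s + of_int i *\<^sub>R period1 M + of_int j *\<^sub>R period2 M)"

definition shift :: "int \<Rightarrow> int \<Rightarrow> label \<Rightarrow> label" where
  "shift m n = (\<lambda>(s, i, j). (s, i + m, j + n))"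

definition crystal_framework :: "motif \<Rightarrow> (label, label) framework" where
  "crystal_framework M =
     \<lparr> joints = {..<length (motif_verts M)} \<times> UNIV,
       bars = {..<length (motif_edges M)} \<times> UNIV,
       ends = (\<lambda>(r, m, n). map_prod (shift m n) (shift m n) (motif_edges M ! r)),
       place = point M \<rparr>"

lemma finite_incident_bars: "finite (incident_bars (crystal_framework M) v)"
proof -
  obtain s i j where v: "v = (s, i, j)" by (cases v)
  let ?sub = "\<lambda>a r. (r, i - fst (snd a), j - snd (snd a))"
  have "incident_bars (crystal_framework M) v
      \<subseteq> (\<Union>r\<in>{..<length (motif_edges M)}.
            {?sub (fst (motif_edges M ! r)) r, ?sub (snd (motif_edges M ! r)) r})"
    by (auto simp: incident_bars_def crystal_framework_def shift_def v split_beta)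
  then show ?thesis by (rule finite_subset) auto
qed

definition phase :: "complex \<Rightarrow> complex \<Rightarrow> label \<Rightarrow> complex" where
  "phase z w = (\<lambda>(s, i, j). cnj z powi i * cnj w powi j)"

text \<open>Column \<open>c\<close> belongs to the motif vertex \<open>c div 2\<close> and to the \<open>x\<close> (even \<open>c\<close>) or \<open>y\<close> (odd \<open>c\<close>)
  coordinate. If both ends of a motif edge are translates of the same motif vertex, the two
  contributions add up.\<close>

definition symbol_function :: "motif \<Rightarrow> complex \<Rightarrow> complex \<Rightarrow> complex mat" where
  "symbol_function M z w =
     mat (length (motif_edges M)) (2 * length (motif_verts M)) (\<lambda>(r, c).
       let (a, b) = motif_edges M ! r;
           v = point M a - point M b;
           x = complex_of_real (if even c then fst v else snd v)
       in (if fst a = c div 2 then phase z w a * x else 0)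
        + (if fst b = c div 2 then - phase z w b * x else 0))"


section \<open>The kagome framework\<close>

definition kagome_motif :: motif where
  "kagome_motif =
     \<lparr> period1 = (1, 0),
       period2 = (1/2, sqrt 3 / 2),
       motif_verts = [(0, 0), (1/2, 0), (1/4, sqrt 3 / 4)],
       motif_edges =
         [((0, 0, 0), (1, 0, 0)),
          ((1, 0, 0), (2, 0, 0)),
          ((0, 0, 0), (2, 0, 0)),
          ((0, 0, 0), (1, -1, 0)),
          ((1, 0, 0), (2, 1, -1)),
          ((2, 0, 0), (0, 0, 1))] \<rparr>"

definition kagome :: "(label, label) framework" where
  "kagome = crystal_framework kagome_motif"

text \<open>Labels are faithful: distinct labels of joints are distinct points, and distinct labels of bars
  have distinct unordered pairs of endpoints.\<close>

lemma kagome_place_inj: "inj_on (place kagome) (joints kagome)"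
proof (rule inj_onI)
  fix a b assume ab: "a \<in> joints kagome" "b \<in> joints kagome" "place kagome a = place kagome b"
  obtain s i j t k l where *: "a = (s, i, j)" "b = (t, k, l)" by (cases a; cases b)
  define X Y :: "nat \<Rightarrow> int" where "X n = (if n = 0 then 0 else if n = 1 then 2 else 1)"
    and "Y n = (if n = 2 then 1 else 0)" for n
  have s: "s \<in> {0, 1, 2}" and t: "t \<in> {0, 1, 2}"
    using ab by (auto simp: * kagome_def crystal_framework_def kagome_motif_def)
  have fst: "4 * fst (point kagome_motif (r, m, n)) = of_int (X r + 4 * m + 2 * n)"
    and snd: "4 * snd (point kagome_motif (r, m, n)) = sqrt 3 * of_int (Y r + 2 * n)"
    if "r \<in> {0, 1, 2}" for r m n
    using that by (auto simp: point_def kagome_motif_def X_def Y_def algebra_simps)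
  have eq: "point kagome_motif (s, i, j) = point kagome_motif (t, k, l)"
    using ab by (simp add: * kagome_def crystal_framework_def)
  have x: "X s + 4 * i + 2 * j = X t + 4 * k + 2 * l"
    using fst[OF s, of i j] fst[OF t, of k l] eq by (metis of_int_eq_iff)
  have "sqrt 3 * real_of_int (Y s + 2 * j) = sqrt 3 * real_of_int (Y t + 2 * l)"
    using snd[OF s, of i j] snd[OF t, of k l] eq by metis
  then have y: "Y s + 2 * j = Y t + 2 * l"
    by (metis mult_cancel_left of_int_eq_iff real_sqrt_eq_zero_cancel_iff zero_neq_numeral)
  show "a = b"
    using s t x y unfolding * X_def Y_def by (elim insertE emptyE; simp) presburger+
qed

lemma kagome_ends_inj:
  "inj_on (\<lambda>e. {fst (ends kagome e), snd (ends kagome e)}) (bars kagome)"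
proof (rule inj_onI)
  fix a b assume ab: "a \<in> bars kagome" "b \<in> bars kagome"
    "{fst (ends kagome a), snd (ends kagome a)} = {fst (ends kagome b), snd (ends kagome b)}"
  obtain s i j t k l where *: "a = (s, i, j)" "b = (t, k, l)" by (cases a; cases b)
  have s: "s \<in> {0, 1, 2, 3, 4, 5}" and t: "t \<in> {0, 1, 2, 3, 4, 5}"
    using ab by (auto simp: * kagome_def crystal_framework_def kagome_motif_def)
  show "a = b"
    using s t ab(3) unfolding *
    by (auto simp: kagome_def crystal_framework_def kagome_motif_def shift_def doubleton_eq_iff)
qed

end

theory Submission
  imports Defs
begin

text \<open>
  The kagome framework is a union of straight lines of bars in three directions, and through every
  joint pass exactly two of these lines. The six motif edges pair off accordingly: the edges in
  positions \<open>k\<close> and \<open>k + 3\<close> are parallel and alternate along one line.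

  In the symbol function, adding row \<open>k\<close> to row \<open>k + 3\<close> therefore cancels the entries at one of the two
  motif vertices and leaves, at the other, the direction of the line times a scalar that vanishes
  when the multiplier of the period along the line is 1. This is the factorization
  \<open>kagome_symbol_factorization\<close> into a lower triangular matrix and an invertible constant
  matrix, and the determinant is the product of the three scalars \<open>1 - z\<close>, \<open>cnj z * w - 1\<close>,
  \<open>cnj w - 1\<close> up to a nonzero constant.

  The isostatic property can be seen on the lines of the framework. A bar forces the velocities of
  its ends to have equal components along the bar, so for a flex the component along a line is
  constant on that line. At a joint, four bars meet in two opposite pairs with independent
  directions, and all bars have the same length, so equilibrium forces a stress to be equal on
  opposite bars, hence constant along each line. A square-summable function that is periodic along
  a line is zero there (\<open>square_summable_periodic_eq_0\<close>). So all stresses vanish, and the velocity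
  of each joint vanishes because its components in two independent directions do.
\<close>

section \<open>The symbol function and its determinant\<close>

definition kagome_symbol :: "complex \<Rightarrow> complex \<Rightarrow> complex mat" where
  "kagome_symbol z w = mat_of_rows_list 6
     (let r = complex_of_real (sqrt 3) in
      [[-2,      0,         2,      0,  0,              0],
       [ 0,      0,         1,     -r, -1,              r],
       [-1,     -r,         0,      0,  1,              r],
       [ 2,      0,        -2*z,    0,  0,              0],
       [ 0,      0,        -1,      r,  cnj z * w,     -r * cnj z * w],
       [cnj w,   r * cnj w, 0,      0, -1,             -r]])"

text \<open>The row operations that recover the symbol function from the constant matrix
  below: row \<open>k + 3\<close> is minus row \<open>k\<close> plus a multiple of a row that involves a single motif vertex.\<close>

definition kagome_line_matrix :: "complex \<Rightarrow> complex \<Rightarrow> complex mat" where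
  "kagome_line_matrix z w = mat_of_rows_list 6
     [[ 1,  0,  0, 0,     0,             0],
      [ 0,  1,  0, 0,     0,             0],
      [ 0,  0,  1, 0,     0,             0],
      [-1,  0,  0, 1 - z, 0,             0],
      [ 0, -1,  0, 0,     cnj z * w - 1, 0],
      [ 0,  0, -1, 0,     0,             cnj w - 1]]"

text \<open>The upper three rows are those of the first three motif edges, times 4. Each of the lower three
  rows is a direction vector of one of the three lines, placed at a motif vertex on that line.\<close>

definition kagome_direction_matrix :: "complex mat" where
  "kagome_direction_matrix = mat_of_rows_list 6
     (let r = complex_of_real (sqrt 3) in
      [[-2,  0, 2,  0,  0,  0],
       [ 0,  0, 1, -r, -1,  r],
       [-1, -r, 0,  0,  1,  r],
       [ 0,  0, 2,  0,  0,  0],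
       [ 0,  0, 0,  0,  1, -r],
       [ 1,  r, 0,  0,  0,  0]])"

lemma all_less_6: "(i::nat) < 6 \<longleftrightarrow> i \<in> {0, 1, 2, 3, 4, 5}"
  by auto

lemma eq_mat_6I:
  assumes "A \<in> carrier_mat 6 6" "B \<in> carrier_mat 6 6"
    and "\<And>i j. i \<in> {0, 1, 2, 3, 4, 5} \<Longrightarrow> j \<in> {0, 1, 2, 3, 4, 5} \<Longrightarrow> A $$ (i, j) = B $$ (i, j)"
  shows "A = B"
  using assms by (intro eq_matI) (auto simp: all_less_6 simp del: One_nat_def insert_iff)

lemma kagome_matrices_carrier:
  "kagome_symbol z w \<in> carrier_mat 6 6"
  "kagome_line_matrix z w \<in> carrier_mat 6 6"
  "kagome_direction_matrix \<in> carrier_mat 6 6"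
  by (simp_all add: kagome_symbol_def kagome_line_matrix_def kagome_direction_matrix_def
      mat_of_rows_list_def Let_def eval_nat_numeral)

lemma sum_upt_6: "(\<Sum>k = 0..<6. f k) = f 0 + f 1 + f 2 + f 3 + f 4 + f (5::nat)"
  by (simp add: eval_nat_numeral)

lemma symbol_function_kagome:
  assumes "norm z = 1" "norm w = 1"
  shows "symbol_function kagome_motif z w = (1/4) \<cdot>\<^sub>m kagome_symbol z w"
proof -
  \<comment> \<open>On the torus, the phases with exponent -1 become \<open>z\<close> and \<open>w\<close>.\<close>
  have "cnj z * z = 1" "cnj w * w = 1"
    using assms by (simp_all add: complex_norm_square[symmetric] mult.commute)
  then have unit: "inverse (cnj z) = z" "inverse (cnj w) = w"
    by (simp_all add: inverse_unique)
  show ?thesis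
  proof (rule eq_mat_6I)
    show "symbol_function kagome_motif z w \<in> carrier_mat 6 6"
      by (simp add: symbol_function_def kagome_motif_def eval_nat_numeral)
    show "(1/4) \<cdot>\<^sub>m kagome_symbol z w \<in> carrier_mat 6 6"
      by (simp add: kagome_matrices_carrier)
  qed (elim insertE emptyE; simp add: symbol_function_def kagome_symbol_def kagome_motif_def
      mat_of_rows_list_def point_def phase_def Let_def unit power_int_minus)+
qed

lemma kagome_symbol_factorization:
  "kagome_symbol z w = kagome_line_matrix z w * kagome_direction_matrix"
proof (rule eq_mat_6I)
  show "kagome_line_matrix z w * kagome_direction_matrix \<in> carrier_mat 6 6"
    by (rule mult_carrier_mat[OF kagome_matrices_carrier(2,3)])
qed (rule kagome_matrices_carrier, (elim insertE emptyE; simp add: kagome_symbol_def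
    kagome_line_matrix_def kagome_direction_matrix_def mat_of_rows_list_def scalar_prod_def
    sum_upt_6 Let_def algebra_simps)+)

lemma det_kagome_line_matrix:
  "det (kagome_line_matrix z w) = (1 - z) * (cnj z * w - 1) * (cnj w - 1)"
proof -
  have "det (kagome_line_matrix z w) = prod_list (diag_mat (kagome_line_matrix z w))"
  proof (rule det_lower_triangular[OF _ kagome_matrices_carrier(2)])
    show "kagome_line_matrix z w $$ (i, j) = 0" if "i < j" "j < 6" for i j
    proof -
      have "i \<in> {0, 1, 2, 3, 4, 5}" "j \<in> {0, 1, 2, 3, 4, 5}"
        using that all_less_6[of i] all_less_6[of j] by simp_all
      with \<open>i < j\<close> show ?thesis
        by (elim insertE emptyE; simp add: kagome_line_matrix_def mat_of_rows_list_def)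
    qed
  qed
  then show ?thesis
    by (simp add: diag_mat_def kagome_line_matrix_def mat_of_rows_list_def upt_rec)
qed

text \<open>A kernel vector assigns to the second motif vertex a velocity with horizontal component 0, to
  the third and first one velocities with component 0 along the other two directions. The first three
  rows then give each vertex component 0 along its other line as well, so the vector is 0. Solving
  the system with a general right-hand side in this order gives the inverse matrix \<open>B\<close>.\<close>

lemma det_kagome_direction_matrix_nonzero: "det kagome_direction_matrix \<noteq> 0"
proof -
  define r where "r = complex_of_real (sqrt 3)"
  have r: "r \<noteq> 0" by (simp add: r_def)
  define B where "B = mat_of_rows_list 6
     [[-1/2,     0,    0,       1/2,      0,         0],
      [1/(2*r),  0,    0,       -1/(2*r), 0,         1/r],
      [0,        0,    0,       1/2,      0,         0],
      [0,        -1/r, 0,       1/(2*r),  -1/r,      0],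
      [0,        0,    1/2,     0,        1/2,       1/2],
      [0,        0,    1/(2*r), 0,        -1/(2*r),  1/(2*r)]]"
  have B: "B \<in> carrier_mat 6 6"
    by (simp add: B_def mat_of_rows_list_def eval_nat_numeral)
  have "kagome_direction_matrix * B = 1\<^sub>m 6"
  proof (rule eq_mat_6I)
    show "kagome_direction_matrix * B \<in> carrier_mat 6 6"
      by (rule mult_carrier_mat[OF kagome_matrices_carrier(3) B])
  qed (rule one_carrier_mat, (elim insertE emptyE; simp add: kagome_direction_matrix_def B_def
      mat_of_rows_list_def scalar_prod_def sum_upt_6 Let_def r_def[symmetric] r)+)
  then have "det kagome_direction_matrix * det B = 1"
    using det_mult[OF kagome_matrices_carrier(3) B] by simp
  then show ?thesis by auto
qed

lemma det_kagome_symbol_function: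
  assumes "norm z = 1" "norm w = 1"
  shows "det (symbol_function kagome_motif z w) =
    (1/4)^6 * det kagome_direction_matrix * (z * w * (cnj z - 1) * (cnj w - 1) * (cnj z - cnj w))"
proof -
  have unit: "z * cnj z = 1" "w * cnj w = 1"
    using assms by (simp_all add: complex_norm_square[symmetric])
  have "(1 - z) * (cnj z * w - 1) * (cnj w - 1)
      = (z * cnj z - z) * (cnj z * w - w * cnj w) * (cnj w - 1)"
    by (simp add: unit)
  also have "\<dots> = z * w * (cnj z - 1) * (cnj w - 1) * (cnj z - cnj w)"
    by (simp add: algebra_simps)
  finally have "det (kagome_symbol z w) = det kagome_direction_matrix
      * (z * w * (cnj z - 1) * (cnj w - 1) * (cnj z - cnj w))"
    unfolding kagome_symbol_factorization det_mult[OF kagome_matrices_carrier(2,3)]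
      det_kagome_line_matrix by (simp only: mult.commute)
  moreover have "dim_col (kagome_symbol z w) = 6"
    using kagome_matrices_carrier(1) by blast
  ultimately show ?thesis
    by (simp add: symbol_function_kagome[OF assms])
qed

section \<open>Square-summable flexes and stresses\<close>

text \<open>The labels reached from \<open>(s, i, j)\<close> by multiples of the period \<open>(a, b)\<close> are infinitely many, and
  a constant is summable over an infinite set only if it is 0.\<close>

lemma square_summable_periodic_eq_0:
  fixes h :: "label \<Rightarrow> real"
  assumes summable: "(\<lambda>x. (h x)\<^sup>2) summable_on {..<n} \<times> UNIV"
    and "s < n" and nonzero: "(a, b) \<noteq> (0, 0)"
    and periodic: "\<And>i j. h (s, i + a, j + b) = h (s, i, j)"
  shows "h (s, i, j) = 0"
proof -
  define g where "g k = (s, i + int k * a, j + int k * b)" for k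
  have inj: "inj g"
    using nonzero by (auto simp: inj_def g_def)
  have const: "h (g k) = h (s, i, j)" for k
  proof (induction k)
    case (Suc k)
    have "h (g (Suc k)) = h (s, (i + int k * a) + a, (j + int k * b) + b)"
      by (simp add: g_def algebra_simps)
    with Suc show ?case by (simp only: periodic) (simp add: g_def)
  qed (simp add: g_def)
  have "(\<lambda>x. (h x)\<^sup>2) summable_on range g"
    using summable by (rule summable_on_subset_banach) (auto simp: g_def \<open>s < n\<close>)
  then have "(\<lambda>k::nat. (h (s, i, j))\<^sup>2) summable_on UNIV"
    using inj by (simp add: summable_on_reindex o_def const)
  then have "summable (\<lambda>k::nat. (h (s, i, j))\<^sup>2)"
    by (rule summable_on_imp_summable)
  then show ?thesis
    by (simp add: summable_const_iff)
qed

lemma square_summable_inner: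
  fixes u :: "'a \<Rightarrow> 'b::real_inner"
  assumes "(\<lambda>x. (norm (u x))\<^sup>2) summable_on A"
  shows "(\<lambda>x. (u x \<bullet> d)\<^sup>2) summable_on A"
proof (rule summable_on_comparison_test)
  show "(\<lambda>x. (norm (u x))\<^sup>2 * (norm d)\<^sup>2) summable_on A"
    using assms by (rule summable_on_cmult_left)
  show "(u x \<bullet> d)\<^sup>2 \<le> (norm (u x))\<^sup>2 * (norm d)\<^sup>2" for x
    using Cauchy_Schwarz_ineq[of "u x" d] by (simp add: power2_norm_eq_inner)
qed auto

lemma joints_kagome: "joints kagome = {..<3} \<times> UNIV"
  and bars_kagome: "bars kagome = {..<6} \<times> UNIV"
  by (simp_all add: kagome_def crystal_framework_def kagome_motif_def eval_nat_numeral)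

lemma ends_kagome:
  "ends kagome (0, i, j) = ((0, i, j), (1, i, j))"
  "ends kagome (1, i, j) = ((1, i, j), (2, i, j))"
  "ends kagome (2, i, j) = ((0, i, j), (2, i, j))"
  "ends kagome (3, i, j) = ((0, i, j), (1, i - 1, j))"
  "ends kagome (4, i, j) = ((1, i, j), (2, i + 1, j - 1))"
  "ends kagome (5, i, j) = ((2, i, j), (0, i, j + 1))"
  by (simp_all add: kagome_def crystal_framework_def kagome_motif_def shift_def)

lemma place_kagome:
  "place kagome (0, i, j) = (of_int i + of_int j / 2, of_int j * sqrt 3 / 2)"
  "place kagome (1, i, j) = (of_int i + of_int j / 2 + 1/2, of_int j * sqrt 3 / 2)"
  "place kagome (2, i, j) = (of_int i + of_int j / 2 + 1/4, of_int j * sqrt 3 / 2 + sqrt 3 / 4)"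
  by (simp_all add: kagome_def crystal_framework_def kagome_motif_def point_def)

lemma rigidity_map_kagome:
  "rigidity_map kagome u (0, i, j) = - ((u (0, i, j) - u (1, i, j)) \<bullet> (1, 0)) / 2"
  "rigidity_map kagome u (1, i, j) = (u (1, i, j) - u (2, i, j)) \<bullet> (1, - sqrt 3) / 4"
  "rigidity_map kagome u (2, i, j) = - ((u (0, i, j) - u (2, i, j)) \<bullet> (1, sqrt 3)) / 4"
  "rigidity_map kagome u (3, i, j) = (u (0, i, j) - u (1, i - 1, j)) \<bullet> (1, 0) / 2"
  "rigidity_map kagome u (4, i, j) = - ((u (1, i, j) - u (2, i + 1, j - 1)) \<bullet> (1, - sqrt 3)) / 4"
  "rigidity_map kagome u (5, i, j) = - ((u (2, i, j) - u (0, i, j + 1)) \<bullet> (1, sqrt 3)) / 4"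
  by (simp_all add: rigidity_map_def ends_kagome place_kagome inner_prod_def field_simps
      del: One_nat_def)

text \<open>The component of a flex along a line is the same at consecutive joints of the line, hence
  periodic along the line, hence 0. Every joint lies on two lines with independent directions.\<close>

lemma kagome_square_summable_flex_eq_0:
  assumes summable: "(\<lambda>v. (norm (u v))\<^sup>2) summable_on joints kagome"
    and flex: "\<forall>e\<in>bars kagome. rigidity_map kagome u e = 0"
    and "v \<in> joints kagome"
  shows "u v = 0"
proof -
  have zero: "rigidity_map kagome u (k, i, j) = 0" if "k < 6" for k i j
    using flex that by (simp add: bars_kagome)
  note eqs = zero[of 0] zero[of 1] zero[of 2] zero[of 3] zero[of 4] zero[of 5]
  define c where "c d x = u x \<bullet> d" for d x
  have sq: "(\<lambda>x. (c d x)\<^sup>2) summable_on {..<3} \<times> UNIV" for d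
    using summable unfolding c_def joints_kagome by (rule square_summable_inner)
  \<comment> \<open>The first three equations are the bars inside a cell, the last three lead to a
    neighbouring cell; two equations for the same direction give one period of the line.\<close>
  have step: "c (1, 0) (0, i, j) = c (1, 0) (1, i, j)"
    "c (1, - sqrt 3) (1, i, j) = c (1, - sqrt 3) (2, i, j)"
    "c (1, sqrt 3) (0, i, j) = c (1, sqrt 3) (2, i, j)"
    "c (1, 0) (0, i, j) = c (1, 0) (1, i - 1, j)"
    "c (1, - sqrt 3) (1, i, j) = c (1, - sqrt 3) (2, i + 1, j - 1)"
    "c (1, sqrt 3) (2, i, j) = c (1, sqrt 3) (0, i, j + 1)" for i j
    using eqs[of i j] unfolding rigidity_map_kagome c_def by (simp_all add: inner_diff_left)
  have "c (1, 0) (0, i, j) = 0" for i j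
  proof (rule square_summable_periodic_eq_0[OF sq, of _ 1 0])
    show "c (1, 0) (0, i + 1, j + 0) = c (1, 0) (0, i, j)" for i j
      using step(1)[of i j] step(4)[of "i + 1" j] by simp
  qed auto
  moreover have "c (1, - sqrt 3) (1, i, j) = 0" for i j
  proof (rule square_summable_periodic_eq_0[OF sq, of _ 1 "-1"])
    show "c (1, - sqrt 3) (1, i + 1, j + - 1) = c (1, - sqrt 3) (1, i, j)" for i j
      using step(2)[of "i + 1" "j - 1"] step(5)[of i j] by simp
  qed auto
  moreover have "c (1, sqrt 3) (0, i, j) = 0" for i j
  proof (rule square_summable_periodic_eq_0[OF sq, of _ 0 1])
    show "c (1, sqrt 3) (0, i + 0, j + 1) = c (1, sqrt 3) (0, i, j)" for i j
      using step(3,6)[of i j] by simp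
  qed auto
  ultimately have "c (1, 0) (0, i, j) = 0" "c (1, sqrt 3) (0, i, j) = 0"
    "c (1, 0) (1, i, j) = 0" "c (1, - sqrt 3) (1, i, j) = 0"
    "c (1, sqrt 3) (2, i, j) = 0" "c (1, - sqrt 3) (2, i, j) = 0" for i j
    using step(1-3)[of i j] by simp_all
  then have "u (0, i, j) = 0" "u (1, i, j) = 0" "u (2, i, j) = 0" for i j
    by (auto simp: c_def prod_eq_iff inner_prod_def)
  moreover obtain k i j where "v = (k, i, j)" "k < 3"
    using \<open>v \<in> joints kagome\<close> by (cases v) (auto simp: joints_kagome)
  moreover from \<open>k < 3\<close> have "k = 0 \<or> k = 1 \<or> k = 2" by auto
  ultimately show ?thesis by auto
qed

lemma incident_bars_kagome:
  "incident_bars kagome (0, i, j) = {(0, i, j), (3, i, j), (2, i, j), (5, i, j - 1)}"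
  "incident_bars kagome (1, i, j) = {(0, i, j), (3, i + 1, j), (1, i, j), (4, i, j)}"
  "incident_bars kagome (2, i, j) = {(2, i, j), (5, i, j), (1, i, j), (4, i - 1, j + 1)}"
proof -
  have "(e \<in> incident_bars kagome v) \<longleftrightarrow> (\<exists>k i j. e = (k, i, j) \<and> k < 6 \<and>
      (v = fst (ends kagome (k, i, j)) \<or> v = snd (ends kagome (k, i, j))))" for e v
    by (cases e) (auto simp: incident_bars_def bars_kagome)
  note mem = this[unfolded all_less_6 insert_iff empty_iff conj_disj_distribR
      conj_disj_distribL ex_disj_distrib]
  show "incident_bars kagome (0, i, j) = {(0, i, j), (3, i, j), (2, i, j), (5, i, j - 1)}"
    "incident_bars kagome (1, i, j) = {(0, i, j), (3, i + 1, j), (1, i, j), (4, i, j)}"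
    "incident_bars kagome (2, i, j) = {(2, i, j), (5, i, j), (1, i, j), (4, i - 1, j + 1)}"
    by (auto simp: mem ends_kagome simp del: One_nat_def)
qed

text \<open>Opposite bars at a joint push along one line in opposite senses, so only the difference of their
  stresses enters.\<close>

lemma rigidity_transpose_kagome:
  "rigidity_transpose kagome s (0, i, j) =
     ((s (3, i, j) - s (0, i, j)) / 2) *\<^sub>R (1, 0)
     + ((s (5, i, j - 1) - s (2, i, j)) / 4) *\<^sub>R (1, sqrt 3)"
  "rigidity_transpose kagome s (1, i, j) =
     ((s (0, i, j) - s (3, i + 1, j)) / 2) *\<^sub>R (1, 0)
     + ((s (1, i, j) - s (4, i, j)) / 4) *\<^sub>R (1, - sqrt 3)"
  "rigidity_transpose kagome s (2, i, j) =
     ((s (2, i, j) - s (5, i, j)) / 4) *\<^sub>R (1, sqrt 3)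
     + ((s (4, i - 1, j + 1) - s (1, i, j)) / 4) *\<^sub>R (1, - sqrt 3)"
  by (simp_all add: rigidity_transpose_def incident_bars_kagome rigidity_entries_def ends_kagome
      place_kagome prod_eq_iff field_simps del: One_nat_def)

lemma bar_directions_independent:
  "a *\<^sub>R (1, 0) + b *\<^sub>R (1, sqrt 3) = (0 :: real \<times> real) \<longleftrightarrow> a = 0 \<and> b = 0"
  "a *\<^sub>R (1, 0) + b *\<^sub>R (1, - sqrt 3) = (0 :: real \<times> real) \<longleftrightarrow> a = 0 \<and> b = 0"
  "a *\<^sub>R (1, sqrt 3) + b *\<^sub>R (1, - sqrt 3) = (0 :: real \<times> real) \<longleftrightarrow> a = 0 \<and> b = 0"
  by (auto simp: prod_eq_iff)

text \<open>Independence of the two directions at a joint turns equilibrium into equality of the stresses on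
  opposite bars, so a stress is periodic along each line.\<close>

lemma kagome_square_summable_stress_eq_0:
  assumes summable: "(\<lambda>e. (s e)\<^sup>2) summable_on bars kagome"
    and stress: "\<forall>v\<in>joints kagome. rigidity_transpose kagome s v = 0"
    and "e \<in> bars kagome"
  shows "s e = 0"
proof -
  have zero: "rigidity_transpose kagome s (k, i, j) = 0" if "k < 3" for k i j
    using stress that by (simp add: joints_kagome)
  have step: "s (3, i, j) = s (0, i, j)" "s (5, i, j - 1) = s (2, i, j)"
    "s (0, i, j) = s (3, i + 1, j)" "s (1, i, j) = s (4, i, j)"
    "s (2, i, j) = s (5, i, j)" "s (4, i - 1, j + 1) = s (1, i, j)" for i j
    using zero[of 0 i j] zero[of 1 i j] zero[of 2 i j] unfolding rigidity_transpose_kagome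
      bar_directions_independent by simp_all
  note sq = summable[unfolded bars_kagome]
  have "s (0, i, j) = 0" for i j
  proof (rule square_summable_periodic_eq_0[OF sq, of _ 1 0])
    show "s (0, i + 1, j + 0) = s (0, i, j)" for i j
      using step(1)[of "i + 1" j] step(3)[of i j] by simp
  qed auto
  moreover have "s (1, i, j) = 0" for i j
  proof (rule square_summable_periodic_eq_0[OF sq, of _ 1 "-1"])
    show "s (1, i + 1, j + - 1) = s (1, i, j)" for i j
      using step(4)[of i j] step(6)[of "i + 1" "j - 1"] by simp
  qed auto
  moreover have "s (2, i, j) = 0" for i j
  proof (rule square_summable_periodic_eq_0[OF sq, of _ 0 1])
    show "s (2, i + 0, j + 1) = s (2, i, j)" for i j
      using step(2)[of i "j + 1"] step(5)[of i j] by simp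
  qed auto
  ultimately have "s (0, i, j) = 0" "s (1, i, j) = 0" "s (2, i, j) = 0"
    "s (3, i, j) = 0" "s (4, i, j) = 0" "s (5, i, j) = 0" for i j
    using step(1,4,5)[of i j] by simp_all
  moreover obtain k i j where "e = (k, i, j)" "k < 6"
    using \<open>e \<in> bars kagome\<close> by (cases e) (auto simp: bars_kagome)
  ultimately show ?thesis unfolding all_less_6 by auto
qed

theorem proposition5p6:
  shows "(\<forall>z w :: complex. norm z = 1 \<longrightarrow> norm w = 1 \<longrightarrow>
            symbol_function kagome_motif z w =
            (1/4) \<cdot>\<^sub>m mat_of_rows_list 6
              (let r = complex_of_real (sqrt 3) in
               [[-2,      0,         2,      0,  0,              0],
                [ 0,      0,         1,     -r, -1,              r],
                [-1,     -r,         0,      0,  1,              r],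
                [ 2,      0,        -2*z,    0,  0,              0],
                [ 0,      0,        -1,      r,  cnj z * w,     -r * cnj z * w],
                [cnj w,   r * cnj w, 0,      0, -1,             -r]]))
       \<and> (\<exists>c :: complex. c \<noteq> 0 \<and> (\<forall>z w :: complex. norm z = 1 \<longrightarrow> norm w = 1 \<longrightarrow>
            det (symbol_function kagome_motif z w) =
            c * (z * w * (cnj z - 1) * (cnj w - 1) * (cnj z - cnj w))))
       \<and> square_summably_isostatic kagome"
proof (intro conjI exI[of _ "(1/4)^6 * det kagome_direction_matrix"] allI impI)
  show "(1/4)^6 * det kagome_direction_matrix \<noteq> 0"
    using det_kagome_direction_matrix_nonzero by simp
  show "square_summably_isostatic kagome"
    using kagome_square_summable_flex_eq_0 kagome_square_summable_stress_eq_0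
    unfolding square_summably_isostatic_def by blast
qed (rule symbol_function_kagome[unfolded kagome_symbol_def] det_kagome_symbol_function; assumption)+

end
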